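(* For integers $\nu\ge1$ and $n\ge0$, \[ \sum_{\tau=0}^{\infty}(-1)^\tau p\!\left(n-\frac{(\nu+\tau)(\nu+\tau-1)}{2}\right)=N_\nu(n), \] where $p(x)=0$ for negative integers $x$.
   Context: $p(n)$ is the number of partitions of $n$, with $p(x)=0$ for $x<0$. Definition of $N_\nu(n)$ (for $\nu\ge1$, $n\ge0$): for a partition $\lambda_1\ge\dots\ge\lambda_k$ of $n$, its $\nu$-Durfee rectangle is the largest rectangle of height $t$ and width $t+\nu$ fitting in its Young diagram, i.e. $t$ is the largest integer $0\le t\le k$ with $\lambda_t\ge t+\nu$ ($t=0$ always allowed). $N_\nu(n)$ is the number of partitions of $n$ such that each of $1,2,\dots,\nu-1$ occurs as a part at least once and every part below the $\nu$-Durfee rectangle is strictly less than its width, i.e. $\lambda_i<t+\nu$ for all $i>t$. *)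

theory Defs
  imports Complex_Main
begin

definition is_partition :: "nat \<Rightarrow> nat list \<Rightarrow> bool" where
  "is_partition n xs \<longleftrightarrow> sorted_wrt (\<ge>) xs \<and> (\<forall>x\<in>set xs. x > 0) \<and> sum_list xs = n"

(* The extension to the integers encodes the convention p(x) = 0 for x < 0. *)
definition part_num :: "int \<Rightarrow> nat" where
  "part_num x = (if x < 0 then 0 else card {xs. is_partition (nat x) xs})"

(* Lists are indexed from 0, parts of a partition from 1. *)
definition part :: "nat list \<Rightarrow> nat \<Rightarrow> nat" where
  "part xs i = xs ! (i - 1)"

definition durfee_height :: "nat \<Rightarrow> nat list \<Rightarrow> nat" where
  "durfee_height \<nu> xs = Max {t. t \<le> length xs \<and> (t = 0 \<or> part xs t \<ge> t + \<nu>)}"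

definition N_durfee :: "nat \<Rightarrow> nat \<Rightarrow> nat" where
  "N_durfee \<nu> n = card {xs. is_partition n xs \<and> (\<forall>j\<in>{1..<\<nu>}. j \<in> set xs) \<and>
     (\<forall>i. durfee_height \<nu> xs < i \<and> i \<le> length xs \<longrightarrow> part xs i < durfee_height \<nu> xs + \<nu>)}"

(* Finiteness guarantees that the cardinalities above are genuine counts. *)
lemma finite_partitions: "finite {xs. is_partition n xs}"
proof (rule finite_subset)
  show "{xs. is_partition n xs} \<subseteq> {xs. set xs \<subseteq> {..n} \<and> length xs \<le> n}"
  proof (intro subsetI CollectI conjI)
    fix xs x assume "xs \<in> {xs. is_partition n xs}" "x \<in> set xs"
    then show "x \<in> {..n}"
      by (auto simp: is_partition_def intro: member_le_sum_list)
  next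
    fix xs assume "xs \<in> {xs. is_partition n xs}"
    moreover have "(\<forall>x\<in>set xs. x > 0) \<Longrightarrow> length xs \<le> sum_list xs" for xs :: "nat list"
      by (induction xs) (auto simp: Suc_le_eq intro!: add_le_mono)
    ultimately show "length xs \<le> n"
      by (auto simp: is_partition_def)
  qed
  show "finite {xs. set xs \<subseteq> {..n} \<and> length xs \<le> n}"
    by (rule finite_lists_length_le) simp
qed

end

theory Submission
  imports Defs "HOL-Library.Multiset"
begin

text \<open>
  The identity follows by telescoping from
  \<open>N\<^sub>\<nu>(n) + N\<^sub>\<nu>\<^sub>+\<^sub>1(n) = p(n - \<nu>(\<nu> - 1)/2)\<close>. The right-hand side counts the partitions of \<open>n\<close>
  containing \<open>1, \<dots>, \<nu> - 1\<close>. Such a partition, with \<open>\<nu>\<close>-Durfee height \<open>t\<close>, is not counted by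
  \<open>N\<^sub>\<nu>(n)\<close> exactly if its \<open>(t+1)\<close>-st part equals \<open>t + \<nu>\<close>. Removing that part, adding \<open>1\<close> to each
  of the first \<open>t\<close> parts and inserting a new part \<open>\<nu>\<close> yields a partition counted by
  \<open>N\<^sub>\<nu>\<^sub>+\<^sub>1(n)\<close>, again with Durfee height \<open>t\<close>, and this is reversible.
\<close>

section \<open>Encoding of the counted partitions\<close>

definition partitions_containing :: "nat \<Rightarrow> nat \<Rightarrow> nat list set" where
  "partitions_containing \<nu> n = {xs. is_partition n xs \<and> {1..<\<nu>} \<subseteq> set xs}"

text \<open>Bounding the entries of a \<open>drop\<close> instead of indexed parts lets the
  condition be read off from a decomposition \<open>as @ bs\<close>.\<close>

definition durfee_strict :: "nat \<Rightarrow> nat \<Rightarrow> nat list set" where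
  "durfee_strict \<nu> n = {xs \<in> partitions_containing \<nu> n.
     \<forall>x\<in>set (drop (durfee_height \<nu> xs) xs). x < durfee_height \<nu> xs + \<nu>}"

lemma finite_partitions_containing: "finite (partitions_containing \<nu> n)"
  unfolding partitions_containing_def
  by (rule finite_subset[OF _ finite_partitions[of n]]) auto

lemma ball_drop_iff_part:
  "(\<forall>x\<in>set (drop t xs). P x) \<longleftrightarrow> (\<forall>i. t < i \<and> i \<le> length xs \<longrightarrow> P (part xs i))"
proof
  assume L: "\<forall>x\<in>set (drop t xs). P x"
  show "\<forall>i. t < i \<and> i \<le> length xs \<longrightarrow> P (part xs i)"
  proof (intro allI impI)
    fix i assume i: "t < i \<and> i \<le> length xs"
    then have "part xs i = drop t xs ! (i - 1 - t)" "i - 1 - t < length (drop t xs)"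
      by (auto simp: Defs.part_def)
    then show "P (part xs i)" using L nth_mem by metis
  qed
next
  assume R: "\<forall>i. t < i \<and> i \<le> length xs \<longrightarrow> P (part xs i)"
  show "\<forall>x\<in>set (drop t xs). P x"
  proof
    fix x assume "x \<in> set (drop t xs)"
    then obtain j where "j < length xs - t" "x = xs ! (t + j)"
      by (auto simp: in_set_conv_nth)
    \<comment> \<open>Entries count from 0 and parts from 1, so entry \<open>t + j\<close> is part
      \<open>Suc (t + j)\<close>.\<close>
    then show "P x" using R[rule_format, of "Suc (t + j)"] by (auto simp: Defs.part_def)
  qed
qed

lemma N_durfee_eq_card: "N_durfee \<nu> n = card (durfee_strict \<nu> n)"
proof -
  have "{xs. is_partition n xs \<and> (\<forall>j\<in>{1..<\<nu>}. j \<in> set xs) \<and>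
     (\<forall>i. durfee_height \<nu> xs < i \<and> i \<le> length xs \<longrightarrow> part xs i < durfee_height \<nu> xs + \<nu>)}
     = durfee_strict \<nu> n"
    unfolding durfee_strict_def partitions_containing_def ball_drop_iff_part by auto
  then show ?thesis by (simp add: N_durfee_def)
qed

section \<open>Splitting a partition at its Durfee rectangle\<close>

text \<open>A height \<open>t\<close> above \<open>length as\<close> would need an entry of
  \<open>bs\<close> of size at least \<open>t + \<nu>\<close>, which exceeds the bound on
  \<open>bs\<close>. That bound is weak so that parts equal to the width may stand below the
  rectangle.\<close>

lemma durfee_height_append:
  assumes "\<forall>x\<in>set as. x \<ge> length as + \<nu>" "\<forall>x\<in>set bs. x \<le> length as + \<nu>"
  shows "durfee_height \<nu> (as @ bs) = length as"
  unfolding durfee_height_def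
proof (rule Max_eqI)
  show "finite {t. t \<le> length (as @ bs) \<and> (t = 0 \<or> t + \<nu> \<le> part (as @ bs) t)}"
    by (rule finite_subset[of _ "{..length (as @ bs)}"]) auto
next
  fix t assume t: "t \<in> {t. t \<le> length (as @ bs) \<and> (t = 0 \<or> t + \<nu> \<le> part (as @ bs) t)}"
  show "t \<le> length as"
  proof (rule ccontr)
    assume c: "\<not> t \<le> length as"
    then have "part (as @ bs) t \<in> set bs" using t
      by (auto simp: Defs.part_def nth_append)
    then show False using assms(2) t c by fastforce
  qed
next
  \<comment> \<open>The last entry of \<open>as\<close> witnesses admissibility; for empty
    \<open>as\<close> the height 0 is always admissible.\<close>
  show "length as \<in> {t. t \<le> length (as @ bs) \<and> (t = 0 \<or> t + \<nu> \<le> part (as @ bs) t)}"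
    using assms(1) by (cases as rule: rev_cases) (auto simp: Defs.part_def nth_append)
qed

lemma durfee_split:
  assumes "sorted_wrt (\<ge>) xs"
  obtains as bs where "xs = as @ bs" "length as = durfee_height \<nu> xs"
    "\<forall>x\<in>set as. x \<ge> length as + \<nu>" "\<forall>x\<in>set bs. x \<le> length as + \<nu>"
proof -
  let ?S = "{t. t \<le> length xs \<and> (t = 0 \<or> t + \<nu> \<le> part xs t)}"
  let ?t = "durfee_height \<nu> xs"
  have fin: "finite ?S" by (rule finite_subset[of _ "{..length xs}"]) auto
  have "?t \<in> ?S" unfolding durfee_height_def by (rule Max_in[OF fin]) auto
  then have t: "?t \<le> length xs" "?t = 0 \<or> ?t + \<nu> \<le> xs ! (?t - 1)" by (auto simp: Defs.part_def)
  have up: "x \<ge> ?t + \<nu>" if "x \<in> set (take ?t xs)" for x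
  proof -
    from that obtain i where i: "i < ?t" "x = xs ! i" "i < length xs"
      by (auto simp: in_set_conv_nth)
    have "xs ! i \<ge> xs ! (?t - 1)"
      using assms i t(1) by (cases "i = ?t - 1") (auto simp: sorted_wrt_iff_nth_less)
    then show ?thesis using t(2) i by auto
  qed
  have down: "x \<le> ?t + \<nu>" if "x \<in> set (drop ?t xs)" for x
  proof -
    from that obtain j where j: "?t + j < length xs" "x = xs ! (?t + j)"
      by (auto simp: in_set_conv_nth less_diff_conv add.commute)
    \<comment> \<open>By maximality \<open>Suc ?t\<close> is inadmissible. Part
      \<open>Suc ?t\<close> is entry \<open>?t\<close>, which is therefore less than
      \<open>Suc ?t + \<nu>\<close>.\<close>
    have "Suc ?t \<notin> ?S"
      using Max_ge[OF fin, of "Suc ?t"] unfolding durfee_height_def by linarith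
    then have "xs ! ?t \<le> ?t + \<nu>" using j by (auto simp: Defs.part_def)
    moreover have "xs ! (?t + j) \<le> xs ! ?t"
      using assms j by (cases "j = 0") (auto simp: sorted_wrt_iff_nth_less)
    ultimately show ?thesis using j by simp
  qed
  show thesis
    by (rule that[of "take ?t xs" "drop ?t xs"]) (use t up down in auto)
qed

section \<open>Counting partitions with prescribed parts\<close>

text \<open>Reduces equality of partitions to equality of multisets, where inserting a part and
  removing it again cancel at once.\<close>

lemma desc_sorted_mset_unique:
  fixes xs ys :: "nat list"
  assumes "sorted_wrt (\<ge>) xs" "sorted_wrt (\<ge>) ys" "mset xs = mset ys"
  shows "xs = ys"
proof -
  have "sorted (rev xs)" "sorted (rev ys)" using assms by (simp_all add: sorted_wrt_rev)
  then have "rev xs = rev ys" using assms(3)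
    by (metis mset_rev properties_for_sort)
  then show ?thesis by simp
qed

lemma desc_sorted_rev_sort: "sorted_wrt (\<ge>) (rev (sort (xs :: nat list)))"
  by (simp add: sorted_wrt_rev)

lemma sorted_wrt_remove1: "sorted_wrt P xs \<Longrightarrow> sorted_wrt P (remove1 x xs)"
  by (induction xs) (auto dest: notin_set_remove1)

text \<open>Inserting one copy of each of \<open>1, ..., \<nu> - 1\<close> is a bijection; the
  inverse removes one copy of each.\<close>

lemma card_partitions_containing_add:
  "card (partitions_containing \<nu> (m + sum_list [1..<\<nu>])) = card {xs. is_partition m xs}"
proof -
  let ?f = "\<lambda>xs. rev (sort (xs @ [1..<\<nu>]))"
  let ?A = "{xs. is_partition m xs}" and ?B = "partitions_containing \<nu> (m + sum_list [1..<\<nu>])"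
  have inj: "inj_on ?f ?A"
  proof (rule inj_onI)
    fix xs ys assume "xs \<in> ?A" "ys \<in> ?A" and eq: "?f xs = ?f ys"
    then have s: "sorted_wrt (\<ge>) xs" "sorted_wrt (\<ge>) ys" by (auto simp: is_partition_def)
    have "mset (?f xs) = mset (?f ys)" using eq by simp
    then have "mset xs = mset ys" by simp
    then show "xs = ys" using s desc_sorted_mset_unique by blast
  qed
  have "?f ` ?A = ?B"
  proof
    show "?f ` ?A \<subseteq> ?B"
    proof
      fix ys assume "ys \<in> ?f ` ?A"
      then obtain xs where xs: "is_partition m xs" "ys = ?f xs" by blast
      have "sum_list ys = sum_list (xs @ [1..<\<nu>])"
        unfolding xs(2) by (metis mset_rev mset_sort sum_mset_sum_list)
      moreover have "sorted_wrt (\<ge>) ys" unfolding xs(2) by (rule desc_sorted_rev_sort)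
      moreover have "set ys = set xs \<union> {1..<\<nu>}" using xs(2) by auto
      ultimately show "ys \<in> ?B" using xs(1)
        by (auto simp: partitions_containing_def is_partition_def)
    qed
  next
    show "?B \<subseteq> ?f ` ?A"
    proof
      fix ys assume "ys \<in> ?B"
      then have ys: "sorted_wrt (\<ge>) ys" "\<forall>x\<in>set ys. x > 0"
        "sum_list ys = m + sum_list [1..<\<nu>]" "{1..<\<nu>} \<subseteq> set ys"
        by (auto simp: partitions_containing_def is_partition_def)
      \<comment> \<open>The prescribed parts are distinct, so inclusion of sets already gives
        inclusion of multisets.\<close>
      have "mset_set {1..<\<nu>} \<subseteq># mset_set (set_mset (mset ys))"
        using ys(4) by (intro subset_imp_msubset_mset_set) auto
      then have sub: "mset [1..<\<nu>] \<subseteq># mset ys"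
        using mset_set_set_mset_msubset subset_mset.order_trans by (metis mset_upt)
      define xs where "xs = rev (sorted_list_of_multiset (mset ys - mset [1..<\<nu>]))"
      have mx: "mset xs = mset ys - mset [1..<\<nu>]" by (simp add: xs_def)
      have "mset xs + mset [1..<\<nu>] = mset ys" using sub mx by simp
      then have m: "mset (xs @ [1..<\<nu>]) = mset ys" by simp
      have "sum_list (xs @ [1..<\<nu>]) = sum_list ys" using m by (metis sum_mset_sum_list)
      moreover have "sorted_wrt (\<ge>) xs"
        by (simp add: xs_def sorted_wrt_rev)
      moreover have "set xs \<subseteq> set ys" using mset_eq_setD[OF m] by auto
      ultimately have "xs \<in> ?A" using ys by (auto simp: is_partition_def)
      moreover have "?f xs = ys"
        by (rule desc_sorted_mset_unique[OF desc_sorted_rev_sort ys(1)]) (use m in simp)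
      ultimately show "ys \<in> ?f ` ?A" by blast
    qed
  qed
  then show ?thesis using card_image[OF inj] by simp
qed

text \<open>The prescribed parts are distinct entries of \<open>ys\<close>, so their sum is bounded
  by the total. This settles the case of a negative argument of p.\<close>

lemma sum_list_upt_le_partition:
  assumes "ys \<in> partitions_containing \<nu> n"
  shows "sum_list [1..<\<nu>] \<le> n"
proof -
  have ys: "sum_list ys = n" "{1..<\<nu>} \<subseteq> set ys"
    using assms by (auto simp: partitions_containing_def is_partition_def)
  have "sum_list [1..<\<nu>] = \<Sum>{1..<\<nu>}" 
    using sum_list_distinct_conv_sum_set[of "[1..<\<nu>]" "\<lambda>x. x"] by simp
  also have "\<dots> \<le> \<Sum>(set ys)" using ys(2) by (intro sum_mono2) auto
  also have "\<dots> \<le> sum_list ys" by (induction ys) (auto simp: sum.insert_if)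
  finally show ?thesis using ys(1) by simp
qed

lemma int_sum_list_upt: "int (sum_list [1..<\<nu>]) = int \<nu> * (int \<nu> - 1) div 2"
proof -
  \<comment> \<open>Doubling removes \<open>div\<close> from the induction; over the integers the
    case \<open>\<nu> = 0\<close> reads \<open>0 = 0 * (-1)\<close>.\<close>
  have "2 * int (sum_list [1..<\<nu>]) = int \<nu> * (int \<nu> - 1)"
    by (induction \<nu>) (auto simp: algebra_simps not_le)
  then show ?thesis by simp
qed

lemma card_partitions_containing:
  "card (partitions_containing \<nu> n) = part_num (int n - int \<nu> * (int \<nu> - 1) div 2)"
proof (cases "sum_list [1..<\<nu>] \<le> n")
  case True
  then have "card (partitions_containing \<nu> n) = card {xs. is_partition (n - sum_list [1..<\<nu>]) xs}"
    using card_partitions_containing_add[of \<nu> "n - sum_list [1..<\<nu>]"] by simp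
  then show ?thesis using True
    by (simp add: part_num_def int_sum_list_upt[symmetric] nat_diff_distrib)
next
  case False
  then have "partitions_containing \<nu> n = {}" using sum_list_upt_le_partition by blast
  then show ?thesis using False
    by (simp add: part_num_def int_sum_list_upt[symmetric])
qed

section \<open>The bijection behind the recurrence\<close>

text \<open>Meant for lists whose entry \<open>t\<close> equals the width \<open>t + \<nu>\<close>,
  which \<open>drop (Suc t)\<close> discards. The total is preserved: the lost
  \<open>t + \<nu>\<close> returns as \<open>t\<close> increments and one part
  \<open>\<nu>\<close>.\<close>

definition shift_up :: "nat \<Rightarrow> nat list \<Rightarrow> nat list" where
  "shift_up \<nu> xs = (let t = durfee_height \<nu> xs in
     map Suc (take t xs) @ rev (sort (\<nu> # drop (Suc t) xs)))"

definition shift_down :: "nat \<Rightarrow> nat list \<Rightarrow> nat list" where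
  "shift_down \<nu> ys = (let t = durfee_height (Suc \<nu>) ys in
     map (\<lambda>y. y - 1) (take t ys) @ (t + \<nu>) # remove1 \<nu> (drop t ys))"

lemma shift_up_append:
  assumes "\<forall>x\<in>set as. x \<ge> length as + \<nu>" "\<forall>x\<in>set bs. x \<le> length as + \<nu>"
  shows "shift_up \<nu> (as @ (length as + \<nu>) # bs) = map Suc as @ rev (sort (\<nu> # bs))"
proof -
  have "durfee_height \<nu> (as @ (length as + \<nu>) # bs) = length as"
    by (rule durfee_height_append) (use assms in auto)
  then show ?thesis by (simp add: shift_up_def Let_def)
qed

text \<open>Passing to \<open>Suc \<nu>\<close> widens the rectangle by one, and so do the
  incremented entries; hence the height is still \<open>length as\<close>.\<close>

lemma shift_down_append:
  assumes "\<forall>x\<in>set as. x \<ge> length as + \<nu>" "\<forall>x\<in>set cs. x \<le> length as + \<nu>"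
  shows "shift_down \<nu> (map Suc as @ cs) = as @ (length as + \<nu>) # remove1 \<nu> cs"
proof -
  have "durfee_height (Suc \<nu>) (map Suc as @ cs) = length (map Suc as)"
    by (rule durfee_height_append) (use assms in auto)
  then show ?thesis by (simp add: shift_down_def Let_def o_def)
qed

text \<open>Strictness fails through some part below the rectangle that is at least the width. The
  first part below is the largest of these and at most the width, so it equals the width.\<close>

lemma not_durfee_strictE:
  assumes "xs \<in> partitions_containing \<nu> n - durfee_strict \<nu> n"
  obtains as bs where "xs = as @ (length as + \<nu>) # bs"
    "sorted_wrt (\<ge>) as" "sorted_wrt (\<ge>) bs"
    "\<forall>x\<in>set as. x \<ge> length as + \<nu>" "\<forall>x\<in>set bs. x \<le> length as + \<nu>" "\<forall>x\<in>set bs. x > 0"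
    "{1..<\<nu>} \<subseteq> set bs" "sum_list as + (length as + \<nu>) + sum_list bs = n"
proof -
  have xs: "sorted_wrt (\<ge>) xs" "\<forall>x\<in>set xs. x > 0" "sum_list xs = n" "{1..<\<nu>} \<subseteq> set xs"
    using assms by (auto simp: partitions_containing_def is_partition_def)
  obtain as ds where d: "xs = as @ ds" "length as = durfee_height \<nu> xs"
    "\<forall>x\<in>set as. x \<ge> length as + \<nu>" "\<forall>x\<in>set ds. x \<le> length as + \<nu>"
    using durfee_split[OF xs(1)] by metis
  have "drop (durfee_height \<nu> xs) xs = ds" using d(1,2) by (metis append_eq_conv_conj)
  then obtain y where y: "y \<in> set ds" "y \<ge> length as + \<nu>"
    using assms d(2) by (auto simp: durfee_strict_def)
  then obtain b bs where ds: "ds = b # bs" by (cases ds) auto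
  have "b \<ge> y" using xs(1) y(1) d(1) ds by (auto simp: sorted_wrt_append)
  then have b: "b = length as + \<nu>" using y(2) d(4) ds by auto
  show thesis
  proof (rule that[of as bs])
    show "{1..<\<nu>} \<subseteq> set bs"
    proof
      fix j assume j: "j \<in> {1..<\<nu>}"
      then have "j \<in> set as \<or> j = b \<or> j \<in> set bs" using xs(4) d(1) ds by auto
      \<comment> \<open>\<open>j < \<nu>\<close>, whereas \<open>b\<close> and all entries of
        \<open>as\<close> are at least \<open>\<nu>\<close>.\<close>
      then show "j \<in> set bs" using j b d(3) by fastforce
    qed
  qed (use xs d(1,3,4) ds b in \<open>auto simp: sorted_wrt_append\<close>)
qed

text \<open>\<open>\<nu> \<ge> 1\<close> makes the part \<open>length as + \<nu>\<close> positive
  even when \<open>as\<close> is empty.\<close>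

lemma not_durfee_strictI:
  assumes "sorted_wrt (\<ge>) as" "sorted_wrt (\<ge>) bs" "\<nu> \<ge> 1"
    "\<forall>x\<in>set as. x \<ge> length as + \<nu>" "\<forall>x\<in>set bs. x \<le> length as + \<nu>" "\<forall>x\<in>set bs. x > 0"
    "{1..<\<nu>} \<subseteq> set bs" "sum_list as + (length as + \<nu>) + sum_list bs = n"
  shows "as @ (length as + \<nu>) # bs \<in> partitions_containing \<nu> n - durfee_strict \<nu> n"
proof -
  let ?xs = "as @ (length as + \<nu>) # bs"
  have h: "durfee_height \<nu> ?xs = length as"
    by (rule durfee_height_append) (use assms in auto)
  have "?xs \<notin> durfee_strict \<nu> n" by (simp add: durfee_strict_def h)
  moreover have "x \<ge> y" if "x \<in> set as" "y \<in> set bs" for x y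
    using that assms(4,5) by (meson order_trans)
  ultimately show ?thesis using assms
    by (fastforce simp: partitions_containing_def is_partition_def sorted_wrt_append)
qed

text \<open>At height \<open>t\<close> the width is \<open>t + Suc \<nu>\<close>. Strictness bounds
  the lower parts by \<open>t + \<nu>\<close>, and the upper parts are successors of numbers at
  least \<open>t + \<nu>\<close>: the same bounds as in \<open>not_durfee_strictE\<close>.\<close>

lemma durfee_strict_SucE:
  assumes "ys \<in> durfee_strict (Suc \<nu>) n"
  obtains as cs where "ys = map Suc as @ cs"
    "sorted_wrt (\<ge>) as" "sorted_wrt (\<ge>) cs"
    "\<forall>x\<in>set as. x \<ge> length as + \<nu>" "\<forall>x\<in>set cs. x \<le> length as + \<nu>" "\<forall>x\<in>set cs. x > 0"
    "{1..<Suc \<nu>} \<subseteq> set cs" "sum_list as + length as + sum_list cs = n"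
proof -
  have ys: "sorted_wrt (\<ge>) ys" "\<forall>x\<in>set ys. x > 0" "sum_list ys = n" "{1..<Suc \<nu>} \<subseteq> set ys"
    using assms by (auto simp: durfee_strict_def partitions_containing_def is_partition_def)
  obtain es cs where d: "ys = es @ cs" "length es = durfee_height (Suc \<nu>) ys"
    "\<forall>x\<in>set es. x \<ge> length es + Suc \<nu>" "\<forall>x\<in>set cs. x \<le> length es + Suc \<nu>"
    using durfee_split[OF ys(1)] by metis
  have "drop (durfee_height (Suc \<nu>) ys) ys = cs" using d(1,2) by (metis append_eq_conv_conj)
  then have cs: "\<forall>x\<in>set cs. x \<le> length es + \<nu>"
    using assms d(2) by (auto simp: durfee_strict_def)
  define as where "as = map (\<lambda>x. x - 1) es"
  \<comment> \<open>All entries of \<open>es\<close> are positive, so the truncated subtraction is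
    undone by \<open>Suc\<close>.\<close>
  have es: "es = map Suc as" unfolding as_def map_map
    by (rule map_idI[symmetric]) (use d(3) in fastforce)
  show thesis
  proof (rule that[of as cs])
    show "{1..<Suc \<nu>} \<subseteq> set cs"
    proof
      fix j assume j: "j \<in> {1..<Suc \<nu>}"
      then have "j \<in> set es \<or> j \<in> set cs" using ys(4) d(1) by auto
      then show "j \<in> set cs" using j d(3) by fastforce
    qed
    show "sum_list as + length as + sum_list cs = n"
      using ys(3) d(1) es sum_list_Suc[of "\<lambda>x. x" as] by simp
  qed (use ys d(1,3) es cs in \<open>auto simp: sorted_wrt_append sorted_wrt_map\<close>)
qed

lemma durfee_strict_SucI:
  assumes "sorted_wrt (\<ge>) as" "sorted_wrt (\<ge>) cs"
    "\<forall>x\<in>set as. x \<ge> length as + \<nu>" "\<forall>x\<in>set cs. x \<le> length as + \<nu>" "\<forall>x\<in>set cs. x > 0"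
    "{1..<Suc \<nu>} \<subseteq> set cs" "sum_list as + length as + sum_list cs = n"
  shows "map Suc as @ cs \<in> durfee_strict (Suc \<nu>) n"
proof -
  let ?ys = "map Suc as @ cs"
  have "durfee_height (Suc \<nu>) ?ys = length (map Suc as)"
    by (rule durfee_height_append) (use assms in auto)
  then have h: "durfee_height (Suc \<nu>) ?ys = length as" by simp
  have "sum_list ?ys = n" using assms(7) sum_list_Suc[of "\<lambda>x. x" as] by simp
  moreover have "y \<le> Suc x" if "x \<in> set as" "y \<in> set cs" for x y
    using that assms(3,4) by (meson order_trans le_SucI)
  moreover have "\<forall>x\<in>set cs. x < length as + Suc \<nu>" using assms(4) by auto
  ultimately show ?thesis using assms h
    by (auto simp: durfee_strict_def partitions_containing_def is_partition_def
        sorted_wrt_append sorted_wrt_map)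
qed

text \<open>In the coordinates of the two decompositions, \<open>as\<close> stays fixed and the
  lower parts \<open>bs\<close> and \<open>cs\<close> differ by exactly one copy of
  \<open>\<nu>\<close>.\<close>

lemma bij_betw_shift_up:
  assumes "\<nu> \<ge> 1"
  shows "bij_betw (shift_up \<nu>) (partitions_containing \<nu> n - durfee_strict \<nu> n)
    (durfee_strict (Suc \<nu>) n)"
proof (rule bij_betw_byWitness[where f' = "shift_down \<nu>"])
  let ?A = "partitions_containing \<nu> n - durfee_strict \<nu> n" and ?B = "durfee_strict (Suc \<nu>) n"
  have A: "shift_up \<nu> xs \<in> ?B \<and> shift_down \<nu> (shift_up \<nu> xs) = xs" if "xs \<in> ?A" for xs
    using that
  proof (rule not_durfee_strictE)
    fix as bs assume H: "xs = as @ (length as + \<nu>) # bs"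
      "sorted_wrt (\<ge>) as" "sorted_wrt (\<ge>) bs"
      "\<forall>x\<in>set as. x \<ge> length as + \<nu>" "\<forall>x\<in>set bs. x \<le> length as + \<nu>" "\<forall>x\<in>set bs. x > 0"
      "{1..<\<nu>} \<subseteq> set bs" "sum_list as + (length as + \<nu>) + sum_list bs = n"
    define cs where "cs = rev (sort (\<nu> # bs))"
    have up: "shift_up \<nu> xs = map Suc as @ cs"
      unfolding H(1) cs_def by (rule shift_up_append[OF H(4,5)])
    have m: "mset cs = add_mset \<nu> (mset bs)" by (simp add: cs_def)
    have set: "set cs = insert \<nu> (set bs)" by (simp add: cs_def set_insort_key)
    have sum: "sum_list cs = \<nu> + sum_list bs"
      using arg_cong[OF m, of sum_mset] by (simp add: sum_mset_sum_list)
    have srt: "sorted_wrt (\<ge>) cs" unfolding cs_def by (rule desc_sorted_rev_sort)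
    have le: "\<forall>x\<in>set cs. x \<le> length as + \<nu>" using set H(5) by auto
    have "map Suc as @ cs \<in> ?B"
      by (rule durfee_strict_SucI[OF H(2) srt H(4) le])
        (use set H assms sum in \<open>auto simp: atLeastLessThanSuc\<close>)
    moreover have "remove1 \<nu> cs = bs"
      by (rule desc_sorted_mset_unique[OF sorted_wrt_remove1[OF srt] H(3)]) (simp add: m)
    ultimately show ?thesis using shift_down_append[OF H(4) le] up H(1) by simp
  qed
  have B: "shift_down \<nu> ys \<in> ?A \<and> shift_up \<nu> (shift_down \<nu> ys) = ys" if "ys \<in> ?B" for ys
    using that
  proof (rule durfee_strict_SucE)
    fix as cs assume H: "ys = map Suc as @ cs"
      "sorted_wrt (\<ge>) as" "sorted_wrt (\<ge>) cs"
      "\<forall>x\<in>set as. x \<ge> length as + \<nu>" "\<forall>x\<in>set cs. x \<le> length as + \<nu>" "\<forall>x\<in>set cs. x > 0"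
      "{1..<Suc \<nu>} \<subseteq> set cs" "sum_list as + length as + sum_list cs = n"
    define bs where "bs = remove1 \<nu> cs"
    have down: "shift_down \<nu> ys = as @ (length as + \<nu>) # bs"
      unfolding H(1) bs_def by (rule shift_down_append[OF H(4,5)])
    \<comment> \<open>The prescribed parts for \<open>Suc \<nu>\<close> include \<open>\<nu>\<close>
      itself, so there is a copy to remove.\<close>
    have "\<nu> \<in> set cs" using H(7) assms by auto
    then have m: "add_mset \<nu> (mset bs) = mset cs" by (simp add: bs_def)
    have sum: "sum_list cs = \<nu> + sum_list bs"
      using arg_cong[OF m, of sum_mset] by (simp add: sum_mset_sum_list)
    have srt: "sorted_wrt (\<ge>) bs" unfolding bs_def by (rule sorted_wrt_remove1[OF H(3)])
    have sub: "set bs \<subseteq> set cs" unfolding bs_def by (rule set_remove1_subset)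
    have le: "\<forall>x\<in>set bs. x \<le> length as + \<nu>" using sub H(5) by auto
    have cont: "{1..<\<nu>} \<subseteq> set bs"
    proof
      fix j assume "j \<in> {1..<\<nu>}"
      then have "j \<in> set cs" "j \<noteq> \<nu>" using H(7) by auto
      then show "j \<in> set bs" unfolding bs_def by simp
    qed
    have "as @ (length as + \<nu>) # bs \<in> ?A"
      by (rule not_durfee_strictI[OF H(2) srt assms H(4) le _ cont])
        (use sub H sum in auto)
    moreover have "rev (sort (\<nu> # bs)) = cs"
      by (rule desc_sorted_mset_unique[OF desc_sorted_rev_sort H(3)]) (simp add: m)
    ultimately show ?thesis using shift_up_append[OF H(4) le] down H(1) by simp
  qed
  show "\<forall>xs\<in>?A. shift_down \<nu> (shift_up \<nu> xs) = xs" "shift_up \<nu> ` ?A \<subseteq> ?B"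
    using A by blast+
  show "\<forall>ys\<in>?B. shift_up \<nu> (shift_down \<nu> ys) = ys" "shift_down \<nu> ` ?B \<subseteq> ?A"
    using B by blast+
qed

section \<open>Recurrence and telescoping\<close>

lemma N_durfee_add_N_durfee_Suc:
  assumes "\<nu> \<ge> 1"
  shows "N_durfee \<nu> n + N_durfee (Suc \<nu>) n = part_num (int n - int \<nu> * (int \<nu> - 1) div 2)"
proof -
  have sub: "durfee_strict \<nu> n \<subseteq> partitions_containing \<nu> n" by (auto simp: durfee_strict_def)
  have "N_durfee (Suc \<nu>) n = card (partitions_containing \<nu> n - durfee_strict \<nu> n)"
    using bij_betw_same_card[OF bij_betw_shift_up[OF assms]] by (simp add: N_durfee_eq_card)
  also have "\<dots> = card (partitions_containing \<nu> n) - card (durfee_strict \<nu> n)"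
    using sub finite_partitions_containing by (intro card_Diff_subset) (auto intro: finite_subset)
  \<comment> \<open>\<open>card_mono\<close> ensures that the subtraction of natural numbers does
    not truncate.\<close>
  finally show ?thesis
    using card_mono[OF finite_partitions_containing sub]
    by (simp add: N_durfee_eq_card card_partitions_containing)
qed

text \<open>Beyond this bound \<open>Suc n\<close> is a prescribed part, too large for a partition
  of \<open>n\<close>. This makes the series finite.\<close>

lemma N_durfee_eq_0:
  assumes "\<nu> > Suc n"
  shows "N_durfee \<nu> n = 0"
proof -
  have "partitions_containing \<nu> n = {}"
  proof (rule equals0I)
    fix xs assume "xs \<in> partitions_containing \<nu> n"
    then have "Suc n \<in> set xs" "sum_list xs = n"
      using assms by (auto simp: partitions_containing_def is_partition_def)
    then show False using member_le_sum_list[of "Suc n" xs] by simp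
  qed
  then show ?thesis by (simp add: N_durfee_eq_card durfee_strict_def)
qed

theorem theorem1p10:
  fixes \<nu> n :: nat
  assumes "\<nu> \<ge> 1"
  shows "(\<lambda>\<tau>. (-1) ^ \<tau> *
           int (part_num (int n - (int \<nu> + int \<tau>) * (int \<nu> + int \<tau> - 1) div 2)))
         sums int (N_durfee \<nu> n)"
proof -
  let ?f = "\<lambda>\<tau>. (-1) ^ \<tau> *
    int (part_num (int n - (int \<nu> + int \<tau>) * (int \<nu> + int \<tau> - 1) div 2))"
  have step: "?f \<tau> = (-1) ^ \<tau> * (int (N_durfee (\<nu> + \<tau>) n) + int (N_durfee (\<nu> + Suc \<tau>) n))" for \<tau>
    using N_durfee_add_N_durfee_Suc[of "\<nu> + \<tau>" n] assms by (simp flip: of_nat_add)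
  \<comment> \<open>By the recurrence each term is a signed sum of two neighbouring values, so
    consecutive terms cancel and only the two ends remain.\<close>
  have partial: "(\<Sum>\<tau><m. ?f \<tau>) = int (N_durfee \<nu> n) - (-1) ^ m * int (N_durfee (\<nu> + m) n)" for m
  proof (induction m)
    case (Suc m)
    then show ?case unfolding sum.lessThan_Suc step[of m] by (simp add: algebra_simps)
  qed simp
  \<comment> \<open>For \<open>\<tau> \<ge> n + 2\<close> both indices \<open>\<nu> + \<tau>\<close>
    and \<open>\<nu> + Suc \<tau>\<close> exceed \<open>Suc n\<close>.\<close>
  have zero: "?f \<tau> = 0" if "\<tau> \<notin> {..<n + 2}" for \<tau>
    using that unfolding step by (simp add: N_durfee_eq_0)
  have "?f sums (\<Sum>\<tau><n + 2. ?f \<tau>)"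
    by (rule sums_finite) (use zero in auto)
  \<comment> \<open>The remainder at \<open>m = n + 2\<close> vanishes for the same reason.\<close>
  then show ?thesis unfolding partial using assms by (simp add: N_durfee_eq_0)
qed

end
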